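(* Let $A$ be a linear endomorphism of $V$ with $A=-A^*$. Then for all $x,y,z,w\in V$, $$R^{\Lambda}_A(x,y,z,w) = 2R^S_A(x,y,z,w)+R_A^S(x,z,y,w)+R_A^S(x,w,z,y)$$ $$\phantom{R^{\Lambda}_A(x,y,z,w)} = 2R_{\phi}^S (Ax, Ay, z,w) + R^S_{\phi} (Ax,Az,y,w) +R^S_{\phi} (Ax,Aw, z,y).$$
   Context: $V$ is a finite-dimensional real vector space and $\phi$ is a positive definite inner product (symmetric bilinear form) on $V$. $A^*$ denotes the adjoint of $A$ with respect to $\phi$, i.e. $\phi(Ax,y)=\phi(x,A^*y)$. For a linear endomorphism $A$ of $V$, define the multilinear maps $V^4\to\mathbb{R}$ $$R^S_{A}(x,y,z,w)= \phi (Ax,w) \phi (Ay,z) - \phi (Ax,z) \phi (Ay,w),$$ $$R^{\Lambda}_{A} (x,y,z,w) =\phi (Ax,w) \phi (Ay,z) - \phi (Ax,z) \phi (Ay,w) -2 \phi (Ax,y) \phi (Az,w).$$ These formulas make sense for any endomorphism $A$ (they need not be algebraic curvature tensors). $R^S_\phi$ denotes $R^S_I$ with $I$ the identity, i.e. $R^S_\phi(x,y,z,w)=\phi(x,w)\phi(y,z)-\phi(x,z)\phi(y,w)$. *)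

theory Defs
  imports "HOL-Analysis.Analysis"
begin

definition pos_def_inner_product :: "('a::real_vector \<Rightarrow> 'a \<Rightarrow> real) \<Rightarrow> bool" where
  "pos_def_inner_product \<phi> \<longleftrightarrow>
     bilinear \<phi> \<and> (\<forall>x y. \<phi> x y = \<phi> y x) \<and> (\<forall>x. x \<noteq> 0 \<longrightarrow> \<phi> x x > 0)"

(* The library's adjoint is tied to the inner product of the type class real_inner;
   here the inner product is an explicit parameter.  On a finite-dimensional space the
   description is proper: see adjoint_wrt_works and adjoint_wrt_unique below. *)
definition adjoint_wrt ::
    "('a::real_vector \<Rightarrow> 'a \<Rightarrow> real) \<Rightarrow> ('a \<Rightarrow> 'a) \<Rightarrow> 'a \<Rightarrow> 'a" where
  "adjoint_wrt \<phi> A = (THE B. \<forall>x y. \<phi> (A x) y = \<phi> x (B y))"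

definition RS ::
    "('a \<Rightarrow> 'a \<Rightarrow> real) \<Rightarrow> ('a \<Rightarrow> 'a) \<Rightarrow> 'a \<Rightarrow> 'a \<Rightarrow> 'a \<Rightarrow> 'a \<Rightarrow> real" where
  "RS \<phi> A x y z w = \<phi> (A x) w * \<phi> (A y) z - \<phi> (A x) z * \<phi> (A y) w"

definition RLambda ::
    "('a \<Rightarrow> 'a \<Rightarrow> real) \<Rightarrow> ('a \<Rightarrow> 'a) \<Rightarrow> 'a \<Rightarrow> 'a \<Rightarrow> 'a \<Rightarrow> 'a \<Rightarrow> real" where
  "RLambda \<phi> A x y z w =
     \<phi> (A x) w * \<phi> (A y) z - \<phi> (A x) z * \<phi> (A y) w - 2 * \<phi> (A x) y * \<phi> (A z) w"

definition RS_metric :: "('a \<Rightarrow> 'a \<Rightarrow> real) \<Rightarrow> 'a \<Rightarrow> 'a \<Rightarrow> 'a \<Rightarrow> 'a \<Rightarrow> real" where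
  "RS_metric \<phi> = RS \<phi> id"

lemma pos_def_eqI:
  assumes \<phi>: "pos_def_inner_product \<phi>" and eq: "\<And>x. \<phi> x u = \<phi> x v"
  shows "u = v"
proof (rule ccontr)
  assume "u \<noteq> v"
  have bil: "bilinear \<phi>" using \<phi> by (simp add: pos_def_inner_product_def)
  have "\<phi> (u - v) (u - v) = 0"
    using eq bilinear_rsub[OF bil] by simp
  moreover have "\<phi> (u - v) (u - v) > 0"
    using \<phi> \<open>u \<noteq> v\<close> by (simp add: pos_def_inner_product_def)
  ultimately show False by simp
qed

lemma riesz_on_span:
  assumes \<phi>: "pos_def_inner_product \<phi>" and "finite B"
  shows "linear f \<Longrightarrow> \<exists>v\<in>span B. \<forall>x\<in>span B. f x = \<phi> x v"
  using \<open>finite B\<close>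
proof (induction B arbitrary: f rule: finite_induct)
  case empty
  have bil: "bilinear \<phi>" using \<phi> by (simp add: pos_def_inner_product_def)
  show ?case using bilinear_lzero[OF bil] linear_0[OF empty] by simp
next
  case (insert b B)
  have bil: "bilinear \<phi>" and sym: "\<And>x y. \<phi> x y = \<phi> y x"
    using \<phi> by (auto simp: pos_def_inner_product_def)
  note bils = bilinear_ladd[OF bil] bilinear_radd[OF bil] bilinear_lsub[OF bil]
    bilinear_rsub[OF bil] bilinear_lmul[OF bil] bilinear_rmul[OF bil]
  have "linear (\<lambda>x. \<phi> x b)" using bil by (simp add: bilinear_def)
  from insert.IH[OF this] obtain p where
    p: "p \<in> span B" "\<And>x. x \<in> span B \<Longrightarrow> \<phi> x b = \<phi> x p" by blast
  define u where "u = b - p"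
  have orth: "\<phi> x u = 0" if "x \<in> span B" for x
    using p(2)[OF that] by (simp add: u_def bils)
  obtain v where v: "v \<in> span B" "\<And>x. x \<in> span B \<Longrightarrow> f x = \<phi> x v"
    using insert.IH[OF insert.prems] by blast
  define c where "c = f u / \<phi> u u"
  have c: "c * \<phi> u u = f u"
    using \<phi> linear_0[OF insert.prems]
    by (cases "u = 0") (auto simp: c_def pos_def_inner_product_def less_imp_neq)
  have B_sub: "span B \<subseteq> span (insert b B)" by (intro span_mono) auto
  have "u \<in> span (insert b B)"
    unfolding u_def using p(1) B_sub by (auto intro: span_diff span_base)
  hence "v + c *\<^sub>R u \<in> span (insert b B)"
    using v(1) B_sub by (intro span_add span_scale) auto
  moreover have "f x = \<phi> x (v + c *\<^sub>R u)" if x: "x \<in> span (insert b B)" for x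
  proof -
    obtain k where k: "x - k *\<^sub>R b \<in> span B" using x by (auto simp: span_insert)
    define y where "y = (x - k *\<^sub>R b) + k *\<^sub>R p"
    have y: "y \<in> span B" unfolding y_def using k p(1) by (intro span_add span_scale)
    have xy: "x = y + k *\<^sub>R u" by (simp add: y_def u_def algebra_simps)
    have "\<phi> u v = 0" using orth[OF v(1)] sym by simp
    hence "\<phi> x (v + c *\<^sub>R u) = \<phi> y v + k * (c * \<phi> u u)"
      by (simp add: xy bils orth[OF y] algebra_simps)
    also have "\<dots> = f x"
      by (simp add: c xy v(2)[OF y] linear_add[OF insert.prems] linear_scale[OF insert.prems])
    finally show ?thesis by simp
  qed
  ultimately show ?case by blast
qed

lemma adjoint_wrt_unique:
  assumes "pos_def_inner_product \<phi>" and "\<And>x y. \<phi> (A x) y = \<phi> x (B y)"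
  shows "adjoint_wrt \<phi> A = B"
  unfolding adjoint_wrt_def
proof (rule the_equality)
  show "\<forall>x y. \<phi> (A x) y = \<phi> x (B y)" using assms(2) by blast
  show "C = B" if "\<forall>x y. \<phi> (A x) y = \<phi> x (C y)" for C
  proof
    show "C y = B y" for y
      using that assms(2) by (intro pos_def_eqI[OF assms(1)]) metis
  qed
qed

lemma adjoint_wrt_works:
  fixes \<phi> :: "'a::real_vector \<Rightarrow> 'a \<Rightarrow> real"
  assumes fin: "\<exists>B::'a set. finite B \<and> span B = UNIV"
    and \<phi>: "pos_def_inner_product \<phi>" and A: "linear A"
  shows "\<phi> (A x) y = \<phi> x (adjoint_wrt \<phi> A y)"
proof -
  obtain E :: "'a set" where E: "finite E" "span E = UNIV" using fin by blast
  have "\<exists>v. \<forall>x. \<phi> (A x) y = \<phi> x v" for y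
  proof -
    have "linear (\<lambda>x. \<phi> x y)" using \<phi> by (simp add: pos_def_inner_product_def bilinear_def)
    from linear_compose[OF A this] have "linear (\<lambda>x. \<phi> (A x) y)" by (simp add: o_def)
    from riesz_on_span[OF \<phi> E(1) this] show ?thesis using E(2) by auto
  qed
  then obtain B where B: "\<And>x y. \<phi> (A x) y = \<phi> x (B y)" by metis
  show ?thesis using B adjoint_wrt_unique[OF \<phi>, of A B] by simp
qed

end

theory Submission
  imports Defs
begin

text \<open>
  Skew-adjointness of \<open>A\<close> together with symmetry of \<open>\<phi>\<close> says that the bilinear form
  \<open>\<omega> u v = \<phi> (A u) v\<close> is alternating (\<open>adjoint_wrt_skew_alternating\<close>). Each tensor in the
  first identity is a linear combination of products of two values of \<open>\<omega>\<close>, each product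
  belonging to a splitting of \<open>x, y, z, w\<close> into two pairs. The alternating law leaves only one
  product, up to sign, for each of the three splittings: \<open>\<omega> x w * \<omega> y z\<close>,
  \<open>\<omega> x z * \<omega> y w\<close> and \<open>\<omega> x y * \<omega> z w\<close>. The two permuted terms
  contribute \<open>-1\<close>, \<open>+1\<close> and \<open>-2\<close> of these, while \<open>2 R\<^sup>S\<^sub>A\<close> contributes \<open>2\<close>, \<open>-2\<close> and
  \<open>0\<close>; the total \<open>1, -1, -2\<close> is \<open>R\<^sup>\<Lambda>\<^sub>A\<close>.

  The second identity holds term by term: the value \<open>R\<^sup>S\<^sub>A (x, y, z, w)\<close>
  involves \<open>A\<close> only through the vectors \<open>A x\<close> and \<open>A y\<close> (\<open>RS_metric_image\<close>).
\<close>

text \<open>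
  Moving \<open>A\<close> across \<open>\<phi>\<close> costs a sign, and symmetry of \<open>\<phi>\<close> then swaps the arguments back.
  Finite dimension enters through the existence of the adjoint.
\<close>

lemma adjoint_wrt_skew_alternating:
  fixes \<phi> :: "'a::real_vector \<Rightarrow> 'a \<Rightarrow> real"
  assumes "\<exists>B :: 'a set. finite B \<and> span B = UNIV"
    and \<phi>: "pos_def_inner_product \<phi>"
    and "linear A"
    and skew: "A = (\<lambda>v. - adjoint_wrt \<phi> A v)"
  shows "\<phi> (A u) v = - \<phi> (A v) u"
proof -
  have bil: "bilinear \<phi>" and sym: "\<And>x y. \<phi> x y = \<phi> y x"
    using \<phi> by (auto simp: pos_def_inner_product_def)
  have adj: "adjoint_wrt \<phi> A v = - A v"
    using fun_cong[OF skew, of v] by simp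
  have "\<phi> (A u) v = \<phi> u (- A v)"
    using adjoint_wrt_works[OF assms(1-3), of u v] by (simp only: adj)
  also have "\<dots> = - \<phi> (A v) u"
    using bilinear_rneg[OF bil] sym by simp
  finally show ?thesis .
qed

lemma RS_metric_image: "RS_metric \<phi> (A x) (A y) z w = RS \<phi> A x y z w"
  by (simp add: RS_metric_def RS_def)

theorem theorem2p4:
  fixes \<phi> :: "'a::real_vector \<Rightarrow> 'a \<Rightarrow> real" and A :: "'a \<Rightarrow> 'a" and x y z w :: 'a
  assumes "\<exists>B :: 'a set. finite B \<and> span B = UNIV"
    and "pos_def_inner_product \<phi>"
    and "linear A"
    and "A = (\<lambda>v. - adjoint_wrt \<phi> A v)"
  shows "RLambda \<phi> A x y z w =
           2 * RS \<phi> A x y z w + RS \<phi> A x z y w + RS \<phi> A x w z y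
       \<and> 2 * RS \<phi> A x y z w + RS \<phi> A x z y w + RS \<phi> A x w z y =
           2 * RS_metric \<phi> (A x) (A y) z w + RS_metric \<phi> (A x) (A z) y w
             + RS_metric \<phi> (A x) (A w) z y"
proof -
  note alt = adjoint_wrt_skew_alternating[OF assms]
  (* Only these three values of the form have their arguments out of the order x, y, z, w;
     flipping them leaves a linear identity between the three products. *)
  have "RLambda \<phi> A x y z w =
          2 * RS \<phi> A x y z w + RS \<phi> A x z y w + RS \<phi> A x w z y"
    by (simp add: RLambda_def RS_def alt[of z y] alt[of w z] alt[of w y] algebra_simps)
  then show ?thesis
    by (simp add: RS_metric_image)
qed

end
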